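(* Let $n\ge 2$, let $\{J_1,\ldots,J_n\}$ be a chain of intervals in $\mathbb{R}$ with $\partial^-J_i<\partial^-J_{i+1}$ for each $i<n$, and let $\mathcal{F}=\{f_1,\ldots,f_n\}\subseteq \mathrm{Homeo}^+(\mathbb{R})$ satisfy $\operatorname{supp} f_i=J_i$ and $f_i(t)\ge t$ for all $t\in\mathbb{R}$ and all $i$, so that $G=\langle \mathcal{F}\rangle$ is a prechain group. Then there is a natural number $N_0$ (depending on $f_1,\dots,f_n$) such that for all $N\ge N_0$ the group $$G_N:=\langle f^N\mid f\in\mathcal{F}\rangle\le \mathrm{Homeo}^+(\mathbb{R})$$ is a chain group.
   Context: $\mathrm{Homeo}^+(\mathbb{R})$ is the group of orientation preserving homeomorphisms of $\mathbb{R}$. For $f\in\mathrm{Homeo}^+(\mathbb{R})$, $\operatorname{supp} f=\{x: f(x)\ne x\}$. For an interval $J$, $\partial^-J$ denotes its left endpoint (possibly $-\infty$). Chain of intervals: a collection $\{J_1,\ldots,J_n\}$ of nonempty open subintervals of $\mathbb{R}$ (possibly unbounded) such that $J_i\cap J_k=\varnothing$ if $|i-k|>1$, and $J_i\cap J_{i+1}$ is a proper nonempty subinterval of both $J_i$ and $J_{i+1}$ for $1\le i\le n-1$. Prechain group: a group $\langle f_1,\ldots,f_n\rangle\le\mathrm{Homeo}^+(\mathbb{R})$, $n\ge2$, where $\{\operatorname{supp} f_1,\dots,\operatorname{supp} f_n\}$ is a chain of intervals with $\partial^-\operatorname{supp} f_i<\partial^-\operatorname{supp} f_{i+1}$ for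 all $i<n$, and $f_i(t)\ge t$ for all $t$ and $i$. Chain group ($n$-chain group): a group $\langle f_1,\ldots,f_n\rangle\le\mathrm{Homeo}^+(\mathbb{R})$, $n\ge2$, where $\{\operatorname{supp} f_1,\dots,\operatorname{supp} f_n\}$ is a chain of intervals with $\partial^-\operatorname{supp} f_i<\partial^-\operatorname{supp} f_{i+1}$ for all $i<n$, and $f_i(t)\ge t$ for all $t$ and $i$ (that is, a prechain group with generators $f_1,\ldots,f_n$), such that moreover $\langle f_i,f_{i+1}\rangle$ is isomorphic to Thompson's group $F$ for each $i=1,\dots,n-1$. Thompson's group is $F=\langle \{g_i\}_{i\ge0}\mid g_i^{-1}g_jg_i=g_{j+1}\text{ for }0\le i<j\rangle$. *)

theory Defs
  imports
    "HOL-Analysis.Analysis"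
    "HOL-Algebra.Generated_Groups"
begin

subsection \<open>Orientation preserving homeomorphisms of the real line\<close>

definition homeo_plus :: "(real \<Rightarrow> real) monoid" where
  "homeo_plus =
     \<lparr>carrier = {f. (\<exists>g. homeomorphism UNIV UNIV f g) \<and> strict_mono f},
      mult = (\<circ>),
      one = id\<rparr>"

lemma group_homeo_plus: "group homeo_plus"
proof (rule groupI)
  fix f g assume "f \<in> carrier homeo_plus" "g \<in> carrier homeo_plus"
  then show "f \<otimes>\<^bsub>homeo_plus\<^esub> g \<in> carrier homeo_plus"
    unfolding homeo_plus_def
    by (auto simp: strict_mono_o intro: homeomorphism_compose)
next
  show "\<one>\<^bsub>homeo_plus\<^esub> \<in> carrier homeo_plus"
    unfolding homeo_plus_def
    by (auto simp: strict_mono_def homeomorphism_def intro!: exI[of _ id])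
next
  fix f assume "f \<in> carrier homeo_plus"
  then obtain g where g: "homeomorphism UNIV UNIV f g" and f: "strict_mono f"
    by (auto simp: homeo_plus_def)
  have gf: "g (f x) = x" "f (g x) = x" for x
    using g by (auto simp: homeomorphism_def)
  have "strict_mono g"
    using f gf(2) by (intro strict_monoI) (metis strict_mono_less)
  then have "g \<in> carrier homeo_plus"
    using homeomorphism_symD[OF g] by (auto simp: homeo_plus_def)
  then show "\<exists>g\<in>carrier homeo_plus. g \<otimes>\<^bsub>homeo_plus\<^esub> f = \<one>\<^bsub>homeo_plus\<^esub>"
    by (rule bexI[rotated]) (auto simp: homeo_plus_def gf)
qed (auto simp: homeo_plus_def)

text \<open>The support is the open set of moved points; no closure is taken.\<close>

definition supp :: "(real \<Rightarrow> real) \<Rightarrow> real set" where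
  "supp f = {x. f x \<noteq> x}"

definition left_endpoint :: "real set \<Rightarrow> ereal" where
  "left_endpoint J = (INF x\<in>J. ereal x)"

subsection \<open>Thompson's group\<close>

text \<open>
  Words over the generators and their formal inverses are lists of pairs: \<open>(a, True)\<close> stands for
  the generator \<open>a\<close> and \<open>(a, False)\<close> for its inverse. Every element of the type \<open>'a\<close> is a
  generator, and \<open>R\<close> is a set of defining relations \<open>u = v\<close>, given as pairs \<open>(u, v)\<close>.
\<close>

type_synonym 'a word = "('a \<times> bool) list"

inductive_set word_eq :: "('a word \<times> 'a word) set \<Rightarrow> ('a word \<times> 'a word) set"
  for R :: "('a word \<times> 'a word) set" where
  relation: "(u, v) \<in> R \<Longrightarrow> (u, v) \<in> word_eq R"
| cancel: "([(a, b), (a, \<not> b)], []) \<in> word_eq R"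
| refl: "(u, u) \<in> word_eq R"
| sym: "(u, v) \<in> word_eq R \<Longrightarrow> (v, u) \<in> word_eq R"
| trans: "(u, v) \<in> word_eq R \<Longrightarrow> (v, w) \<in> word_eq R \<Longrightarrow> (u, w) \<in> word_eq R"
| append: "(u, v) \<in> word_eq R \<Longrightarrow> (u', v') \<in> word_eq R \<Longrightarrow> (u @ u', v @ v') \<in> word_eq R"

definition presented_group :: "('a word \<times> 'a word) set \<Rightarrow> 'a word set monoid" where
  "presented_group R =
     \<lparr>carrier = UNIV // word_eq R,
      mult = (\<lambda>A B. \<Union>u\<in>A. \<Union>v\<in>B. word_eq R `` {u @ v}),
      one = word_eq R `` {[]}\<rparr>"

lemma equiv_word_eq: "equiv UNIV (word_eq R)"
  by (intro equivI refl_onI symI transI) (simp, rule word_eq.refl, erule word_eq.sym, erule (1) word_eq.trans)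

lemma presented_group_mult:
  "word_eq R `` {u} \<otimes>\<^bsub>presented_group R\<^esub> word_eq R `` {v} = word_eq R `` {u @ v}"
proof -
  have "congruent2 (word_eq R) (word_eq R) (\<lambda>u v. word_eq R `` {u @ v})"
    by (intro congruent2I' equiv_class_eq[OF equiv_word_eq] word_eq.append)
  then show ?thesis
    unfolding presented_group_def
    by (simp add: UN_equiv_class2[OF equiv_word_eq equiv_word_eq])
qed

lemma word_eq_inverse: "(rev (map (\<lambda>(a, b). (a, \<not> b)) u) @ u, []) \<in> word_eq R"
proof (induction u)
  case Nil
  show ?case by (simp add: word_eq.refl)
next
  case (Cons x u)
  obtain a b where x: "x = (a, b)" by force
  let ?u = "rev (map (\<lambda>(a, b). (a, \<not> b)) u)"
  have "([(a, \<not> b), (a, b)] @ u, [] @ u) \<in> word_eq R"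
    using word_eq.cancel[of a "\<not> b"] by (intro word_eq.append word_eq.refl) simp
  then have "(?u @ [(a, \<not> b), (a, b)] @ u, ?u @ u) \<in> word_eq R"
    by (intro word_eq.append word_eq.refl) simp
  with Cons x show ?case by (auto intro: word_eq.trans)
qed

lemma group_presented_group: "group (presented_group R)"
proof (rule groupI)
  have carrier: "x \<in> carrier (presented_group R) \<longleftrightarrow> (\<exists>u. x = word_eq R `` {u})" for x
    by (auto simp: presented_group_def quotient_def)
  have one: "\<one>\<^bsub>presented_group R\<^esub> = word_eq R `` {[]}"
    by (simp add: presented_group_def)
  show "\<one>\<^bsub>presented_group R\<^esub> \<in> carrier (presented_group R)"
    using carrier one by blast
  fix x assume "x \<in> carrier (presented_group R)"
  then obtain u where x: "x = word_eq R `` {u}" using carrier by blast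
  show "\<one>\<^bsub>presented_group R\<^esub> \<otimes>\<^bsub>presented_group R\<^esub> x = x"
    by (simp add: x one presented_group_mult)
  have "word_eq R `` {rev (map (\<lambda>(a, b). (a, \<not> b)) u)} \<otimes>\<^bsub>presented_group R\<^esub> x
      = \<one>\<^bsub>presented_group R\<^esub>"
    unfolding x one presented_group_mult
    by (intro equiv_class_eq[OF equiv_word_eq] word_eq_inverse)
  then show "\<exists>y\<in>carrier (presented_group R). y \<otimes>\<^bsub>presented_group R\<^esub> x = \<one>\<^bsub>presented_group R\<^esub>"
    using carrier by blast
  fix y assume "y \<in> carrier (presented_group R)"
  then obtain v where y: "y = word_eq R `` {v}" using carrier by blast
  show "x \<otimes>\<^bsub>presented_group R\<^esub> y \<in> carrier (presented_group R)"
    unfolding x y presented_group_mult using carrier by blast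
  fix z assume "z \<in> carrier (presented_group R)"
  then obtain w where z: "z = word_eq R `` {w}" using carrier by blast
  show "x \<otimes>\<^bsub>presented_group R\<^esub> y \<otimes>\<^bsub>presented_group R\<^esub> z
      = x \<otimes>\<^bsub>presented_group R\<^esub> (y \<otimes>\<^bsub>presented_group R\<^esub> z)"
    by (simp add: x y z presented_group_mult)
qed

definition thompson_F :: "nat word set monoid" where
  "thompson_F = presented_group
     {([(i, False), (j, True), (i, True)], [(j + 1, True)]) | i j. i < j}"

subsection \<open>Chains of intervals and chain groups\<close>

definition proper_subinterval :: "real set \<Rightarrow> real set \<Rightarrow> bool" where
  "proper_subinterval I J \<longleftrightarrow> is_interval I \<and> I \<subset> J"

definition chain_of_intervals :: "nat \<Rightarrow> (nat \<Rightarrow> real set) \<Rightarrow> bool" where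
  "chain_of_intervals n J \<longleftrightarrow>
     (\<forall>i\<in>{1..n}. is_interval (J i) \<and> open (J i) \<and> J i \<noteq> {}) \<and>
     (\<forall>i\<in>{1..n}. \<forall>k\<in>{1..n}. \<bar>int i - int k\<bar> > 1 \<longrightarrow> J i \<inter> J k = {}) \<and>
     (\<forall>i\<in>{1..<n}. J i \<inter> J (i + 1) \<noteq> {} \<and>
        proper_subinterval (J i \<inter> J (i + 1)) (J i) \<and>
        proper_subinterval (J i \<inter> J (i + 1)) (J (i + 1)))"

definition increasing_left_endpoints :: "nat \<Rightarrow> (nat \<Rightarrow> real set) \<Rightarrow> bool" where
  "increasing_left_endpoints n J \<longleftrightarrow>
     (\<forall>i\<in>{1..<n}. left_endpoint (J i) < left_endpoint (J (i + 1)))"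

text \<open>
  Being a (pre)chain group is understood relative to a generating sequence \<open>f 1, \<dots>, f n\<close>;
  values of \<open>f\<close> outside \<open>{1..n}\<close> are irrelevant.
\<close>

definition prechain_group :: "nat \<Rightarrow> (nat \<Rightarrow> real \<Rightarrow> real) \<Rightarrow> (real \<Rightarrow> real) set \<Rightarrow> bool" where
  "prechain_group n f G \<longleftrightarrow>
     n \<ge> 2 \<and>
     (\<forall>i\<in>{1..n}. f i \<in> carrier homeo_plus) \<and>
     G = generate homeo_plus (f ` {1..n}) \<and>
     chain_of_intervals n (\<lambda>i. supp (f i)) \<and>
     increasing_left_endpoints n (\<lambda>i. supp (f i)) \<and>
     (\<forall>i\<in>{1..n}. \<forall>t. f i t \<ge> t)"

definition chain_group :: "nat \<Rightarrow> (nat \<Rightarrow> real \<Rightarrow> real) \<Rightarrow> (real \<Rightarrow> real) set \<Rightarrow> bool" where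
  "chain_group n f G \<longleftrightarrow>
     prechain_group n f G \<and>
     (\<forall>i\<in>{1..<n}.
        homeo_plus\<lparr>carrier := generate homeo_plus {f i, f (i + 1)}\<rparr> \<cong> thompson_F)"

end

theory Submission
  imports Defs
begin

text \<open>
  It suffices to treat two consecutive generators \<open>f\<close>, \<open>g\<close>. Let \<open>b\<close> be the left endpoint of
  \<open>supp g\<close> and let \<open>s \<in> supp g\<close> lie to the right of \<open>supp f\<close>. For large \<open>N\<close> the powers satisfy
  \<open>g\<^sup>N (f\<^sup>N b) \<ge> s\<close>; replace \<open>f\<close>, \<open>g\<close> by them. Put \<open>k = g \<circ> f\<close>,
  \<open>x\<^sub>0 = k\<inverse>\<close> and \<open>x\<^sub>m\<^sub>+\<^sub>1 = k\<^sup>m g\<inverse> k\<^sup>-\<^sup>m\<close>. Up to conjugation by powers of \<open>k\<close>, Thompson's relations say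
  that \<open>f\<close> commutes with \<open>x\<^sub>2, x\<^sub>3, \<dots>\<close>, which holds since these are supported to the right of \<open>s\<close>.

  The resulting map from \<open>F\<close> is injective: every element of \<open>F\<close> is a quotient \<open>p q\<inverse>\<close> of positive
  words. Let \<open>i\<close> be the least index occurring in \<open>p\<close> or \<open>q\<close>. If it occurs in both, it can be moved
  to the front of both and cancelled. If it occurs in only one of them, \<open>p\<close> and \<open>q\<close> have different
  images, because \<open>x\<^sub>i\<close> moves the point \<open>k\<^sup>i b\<close> to the left, all \<open>x\<^sub>j\<close> with \<open>j > i\<close> fix it, and
  no \<open>x\<^sub>j\<close> moves a point to the right.
\<close>

section \<open>Evaluation of words and homomorphisms out of a presented group\<close>

primrec word_eval :: "('g, 'm) monoid_scheme \<Rightarrow> ('a \<Rightarrow> 'g) \<Rightarrow> 'a word \<Rightarrow> 'g" where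
  "word_eval G x [] = \<one>\<^bsub>G\<^esub>"
| "word_eval G x (z # w) =
     (if snd z then x (fst z) else inv\<^bsub>G\<^esub> x (fst z)) \<otimes>\<^bsub>G\<^esub> word_eval G x w"

primrec gen_prod :: "('g, 'm) monoid_scheme \<Rightarrow> ('a \<Rightarrow> 'g) \<Rightarrow> 'a list \<Rightarrow> 'g" where
  "gen_prod G x [] = \<one>\<^bsub>G\<^esub>"
| "gen_prod G x (i # p) = x i \<otimes>\<^bsub>G\<^esub> gen_prod G x p"

definition thompson_rels :: "(nat word \<times> nat word) set" where
  "thompson_rels = {([(i, False), (j, True), (i, True)], [(j + 1, True)]) | i j. i < j}"

lemma thompson_F_eq: "thompson_F = presented_group thompson_rels"
  by (simp add: thompson_F_def thompson_rels_def)

context group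
begin

lemma word_eval_closed:
  assumes "\<And>i. x i \<in> carrier G"
  shows "word_eval G x w \<in> carrier G"
  using assms by (induction w) auto

lemma gen_prod_closed:
  assumes "\<And>i. x i \<in> carrier G"
  shows "gen_prod G x p \<in> carrier G"
  using assms by (induction p) auto

lemma word_eval_append:
  assumes "\<And>i. x i \<in> carrier G"
  shows "word_eval G x (u @ v) = word_eval G x u \<otimes> word_eval G x v"
  using assms by (induction u) (auto simp: word_eval_closed m_assoc)

lemma word_eval_cong_word_eq:
  assumes x: "\<And>i. x i \<in> carrier G"
    and R: "\<And>u v. (u, v) \<in> R \<Longrightarrow> word_eval G x u = word_eval G x v"
    and "(u, v) \<in> word_eq R"
  shows "word_eval G x u = word_eval G x v"
  using assms(3) by induction (auto simp: R x word_eval_append)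

lemma word_eval_generate:
  assumes x: "\<And>i. x i \<in> carrier G"
  shows "word_eval G x w \<in> generate G (range x)"
  by (induction w) (auto intro: generate.intros)

text \<open>This is von Dyck's theorem. Evaluation is constant on classes because every rule
  generating \<open>word_eq\<close> preserves it, so the choice of a representative in
  \<open>h\<close> is harmless. The image is identified as well, so that only injectivity remains to
  be proved later.\<close>

lemma presented_group_hom:
  assumes x: "\<And>i. x i \<in> carrier G"
    and R: "\<And>u v. (u, v) \<in> R \<Longrightarrow> word_eval G x u = word_eval G x v"
  obtains h where "h \<in> hom (presented_group R) G"
    and "\<And>w. h (word_eq R `` {w}) = word_eval G x w"
    and "h ` carrier (presented_group R) = generate G (range x)"
proof -
  define h where "h A = word_eval G x (SOME w. w \<in> A)" for A
  have h: "h (word_eq R `` {w}) = word_eval G x w" for w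
  proof -
    have "w \<in> word_eq R `` {w}" by (simp add: word_eq.refl)
    then have "(w, SOME v. v \<in> word_eq R `` {w}) \<in> word_eq R"
      by (metis Image_singleton_iff someI)
    then show ?thesis
      unfolding h_def using word_eval_cong_word_eq[OF x R] by metis
  qed
  have carrier: "A \<in> carrier (presented_group R) \<longleftrightarrow> (\<exists>u. A = word_eq R `` {u})" for A
    by (auto simp: presented_group_def quotient_def)
  have hom: "h \<in> hom (presented_group R) G"
    by (rule homI) (auto simp: carrier h word_eval_closed[OF x] presented_group_mult
        word_eval_append[OF x])
  interpret H: group_hom "presented_group R" G h
    by (intro group_hom.intro group_presented_group is_group group_hom_axioms.intro hom)
  have "x i \<in> h ` carrier (presented_group R)" for i
  proof -
    have "h (word_eq R `` {[(i, True)]}) = x i" by (simp add: h x)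
    then show ?thesis using carrier by (metis imageI)
  qed
  then have "generate G (range x) \<subseteq> h ` carrier (presented_group R)"
    by (intro generate_subgroup_incl H.img_is_subgroup) auto
  moreover have "h ` carrier (presented_group R) \<subseteq> generate G (range x)"
    using word_eval_generate[OF x] by (auto simp: carrier h)
  ultimately show ?thesis
    using that hom h by blast
qed

end

section \<open>Fractions of positive words under Thompson's relations\<close>

text \<open>The relations are isolated from any particular group so that the same calculations apply
  to the generators of F and to their images among homeomorphisms.\<close>

locale thompson_sequence = group G for G (structure) +
  fixes x :: "nat \<Rightarrow> 'a"
  assumes x_closed [simp]: "x i \<in> carrier G"
    and x_rel: "i < j \<Longrightarrow> inv x i \<otimes> x j \<otimes> x i = x (Suc j)"
begin

lemma gen_closed [simp]: "gen_prod G x p \<in> carrier G"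
  by (simp add: gen_prod_closed)

lemma x_swap:
  assumes "i < j"
  shows "x j \<otimes> x i = x i \<otimes> x (Suc j)"
  using x_rel[OF assms] by (metis inv_closed inv_solve_left m_assoc m_closed x_closed)

lemma gen_prod_snoc: "gen_prod G x (p @ [i]) = gen_prod G x p \<otimes> x i"
  by (induction p) (auto simp: m_assoc)

lemma inv_x_swap:
  assumes "i < j"
  shows "inv x i \<otimes> x j = x (Suc j) \<otimes> inv x i" "inv x j \<otimes> x i = x i \<otimes> inv x (Suc j)"
proof -
  show "inv x i \<otimes> x j = x (Suc j) \<otimes> inv x i"
    using x_rel[OF assms] by (metis inv_closed inv_solve_right m_closed x_closed)
  show "inv x j \<otimes> x i = x i \<otimes> inv x (Suc j)"
    using x_swap[OF assms]
    by (metis inv_closed inv_solve_left inv_solve_right m_assoc m_closed x_closed)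
qed

text \<open>The letter \<open>x i\<close> travels left through the inverted letters one at a time.
  Meeting its own inverse it cancels, which is the second alternative; otherwise it comes out at the
  front with a possibly raised index.\<close>

lemma inv_gen_prod_times_x:
  "(\<exists>k q'. inv (gen_prod G x q) \<otimes> x i = x k \<otimes> inv (gen_prod G x q'))
    \<or> (\<exists>q'. inv (gen_prod G x q) \<otimes> x i = inv (gen_prod G x q'))"
proof (induction q arbitrary: i)
  case Nil
  have "inv (gen_prod G x []) \<otimes> x i = x i \<otimes> inv (gen_prod G x [])" by simp
  then show ?case by blast
next
  case (Cons j q)
  have eq: "inv (gen_prod G x (j # q)) \<otimes> x i = inv (gen_prod G x q) \<otimes> (inv x j \<otimes> x i)"
    by (simp add: inv_mult_group m_assoc)
  show ?case
  proof (cases "i = j")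
    case True
    then have "inv (gen_prod G x (j # q)) \<otimes> x i = inv (gen_prod G x q)"
      unfolding eq by simp
    then show ?thesis by blast
  next
    case False
    \<comment> \<open>For \<open>i < j\<close> the indices are \<open>k = i\<close> and
      \<open>l = Suc j\<close>; for \<open>j < i\<close> they are \<open>k = Suc i\<close> and
      \<open>l = j\<close>.\<close>
    then obtain k l where kl: "inv x j \<otimes> x i = x k \<otimes> inv x l"
      using inv_x_swap(2)[of i j] inv_x_swap(1)[of j i] by (meson linorder_neqE_nat)
    have eq: "inv (gen_prod G x (j # q)) \<otimes> x i = (inv (gen_prod G x q) \<otimes> x k) \<otimes> inv x l"
      unfolding eq kl by (simp add: m_assoc)
    have snoc: "inv (gen_prod G x r) \<otimes> inv x l = inv (gen_prod G x (l # r))" for r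
      by (simp add: inv_mult_group)
    from Cons[of k] show ?thesis
    proof (elim disjE exE)
      fix k' r assume "inv (gen_prod G x q) \<otimes> x k = x k' \<otimes> inv (gen_prod G x r)"
      then have "inv (gen_prod G x (j # q)) \<otimes> x i = x k' \<otimes> inv (gen_prod G x (l # r))"
        unfolding eq snoc[symmetric] by (simp add: m_assoc)
      then show ?thesis by blast
    next
      fix r assume "inv (gen_prod G x q) \<otimes> x k = inv (gen_prod G x r)"
      then have "inv (gen_prod G x (j # q)) \<otimes> x i = inv (gen_prod G x (l # r))"
        unfolding eq snoc[symmetric] by simp
      then show ?thesis by blast
    qed
  qed
qed

text \<open>The word is read from left to right: an inverse letter joins the denominator, while a
  positive letter is pushed through the denominator and then either joins the numerator or has been
  cancelled.\<close>

lemma word_eval_fraction: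
  "\<exists>p q. word_eval G x w = gen_prod G x p \<otimes> inv (gen_prod G x q)"
proof (induction w rule: rev_induct)
  case Nil
  have "word_eval G x [] = gen_prod G x [] \<otimes> inv (gen_prod G x [])" by simp
  then show ?case by blast
next
  case (snoc z w)
  then obtain p q where pq: "word_eval G x w = gen_prod G x p \<otimes> inv (gen_prod G x q)"
    by blast
  obtain i b where z: "z = (i, b)" by force
  show ?case
  proof (cases b)
    case False
    have "word_eval G x (w @ [z]) = gen_prod G x p \<otimes> inv (gen_prod G x (i # q))"
      by (simp add: word_eval_append pq z False inv_mult_group m_assoc)
    then show ?thesis by blast
  next
    case True
    have eq: "word_eval G x (w @ [z]) = gen_prod G x p \<otimes> (inv (gen_prod G x q) \<otimes> x i)"
      by (simp add: word_eval_append pq z True m_assoc)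
    from inv_gen_prod_times_x[of q i] show ?thesis
    proof (elim disjE exE)
      fix k r assume "inv (gen_prod G x q) \<otimes> x i = x k \<otimes> inv (gen_prod G x r)"
      then have "word_eval G x (w @ [z]) = gen_prod G x (p @ [k]) \<otimes> inv (gen_prod G x r)"
        unfolding eq by (simp add: gen_prod_snoc m_assoc)
      then show ?thesis by blast
    next
      fix r assume "inv (gen_prod G x q) \<otimes> x i = inv (gen_prod G x r)"
      then have "word_eval G x (w @ [z]) = gen_prod G x p \<otimes> inv (gen_prod G x r)"
        unfolding eq by simp
      then show ?thesis by blast
    qed
  qed
qed

text \<open>The first occurrence of \<open>i\<close> is swapped leftwards past strictly larger
  letters, each of which gains 1. The number of letters is recorded because it is the measure for
  the cancellation argument.\<close>

lemma gen_prod_pull_min: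
  assumes "i \<in> set p" "\<forall>j\<in>set p. i \<le> j"
  shows "\<exists>p'. length p = Suc (length p') \<and> gen_prod G x p = x i \<otimes> gen_prod G x p'"
  using assms
proof (induction p)
  case (Cons j p)
  show ?case
  proof (cases "j = i")
    case True
    then show ?thesis by auto
  next
    case False
    with Cons obtain p' where p': "length p = Suc (length p')" "gen_prod G x p = x i \<otimes> gen_prod G x p'"
      by auto
    have "i < j" using False Cons by simp
    then have "gen_prod G x (j # p) = x i \<otimes> gen_prod G x (Suc j # p')"
      by (simp add: p' x_swap flip: m_assoc)
    then show ?thesis using p'(1) by (intro exI[of _ "Suc j # p'"]) simp
  qed
qed simp

end

section \<open>A criterion for generating a copy of Thompson's group\<close>

lemma presented_group_closed: "word_eq R `` {w} \<in> carrier (presented_group R)"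
  by (auto simp: presented_group_def quotient_def)

lemma presented_group_inv:
  "inv\<^bsub>presented_group R\<^esub> (word_eq R `` {[(a, True)]}) = word_eq R `` {[(a, False)]}"
proof -
  interpret P: group "presented_group R" by (rule group_presented_group)
  have "word_eq R `` {[(a, False), (a, True)]} = word_eq R `` {[]}"
    using word_eq.cancel[of a False] by (intro equiv_class_eq[OF equiv_word_eq]) simp
  also have "\<dots> = \<one>\<^bsub>presented_group R\<^esub>"
    by (simp add: presented_group_def)
  finally show ?thesis
    by (intro P.inv_equality presented_group_closed) (simp add: presented_group_mult)
qed

lemma word_eval_presented_group:
  "word_eval (presented_group R) (\<lambda>a. word_eq R `` {[(a, True)]}) w = word_eq R `` {w}"
proof (induction w)
  case Nil
  show ?case by (simp add: presented_group_def)
next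
  case (Cons z w)
  obtain a b where "z = (a, b)" by force
  with Cons show ?case
    by (simp add: presented_group_inv presented_group_mult)
qed

lemma thompson_sequence_thompson_F:
  "thompson_sequence thompson_F (\<lambda>i. word_eq thompson_rels `` {[(i, True)]})"
proof -
  interpret F: group thompson_F
    unfolding thompson_F_eq by (rule group_presented_group)
  show ?thesis
  proof unfold_locales
    fix i j :: nat assume "i < j"
    then have "([(i, False), (j, True), (i, True)], [(Suc j, True)]) \<in> word_eq thompson_rels"
      by (intro word_eq.relation) (auto simp: thompson_rels_def)
    then show "inv\<^bsub>thompson_F\<^esub> (word_eq thompson_rels `` {[(i, True)]})
        \<otimes>\<^bsub>thompson_F\<^esub> word_eq thompson_rels `` {[(j, True)]}
        \<otimes>\<^bsub>thompson_F\<^esub> word_eq thompson_rels `` {[(i, True)]}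
        = word_eq thompson_rels `` {[(Suc j, True)]}"
      unfolding thompson_F_eq presented_group_inv presented_group_mult
      by (simp add: equiv_class_eq[OF equiv_word_eq])
  qed (simp add: thompson_F_eq presented_group_closed)
qed

context thompson_sequence
begin

text \<open>The hypothesis \<open>separated\<close> is the form in which dynamics enters. It makes
  the homomorphism from F injective on positive words, and writing elements as fractions extends
  this to all of F.\<close>

lemma generate_iso_thompson_F:
  assumes separated: "\<And>i p q. i \<in> set p \<Longrightarrow> \<forall>j\<in>set p. i \<le> j \<Longrightarrow> \<forall>j\<in>set q. i < j
      \<Longrightarrow> gen_prod G x p \<noteq> gen_prod G x q"
  shows "G\<lparr>carrier := generate G (range x)\<rparr> \<cong> thompson_F"
proof -
  define y where "y i = word_eq thompson_rels `` {[(i, True)]}" for i :: nat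
  interpret F: thompson_sequence thompson_F y
    unfolding y_def by (rule thompson_sequence_thompson_F)
  have rels: "word_eval G x u = word_eval G x v" if "(u, v) \<in> thompson_rels" for u v
    using that x_rel by (auto simp: thompson_rels_def m_assoc)
  obtain h where hom: "h \<in> hom thompson_F G"
    and h: "\<And>w. h (word_eq thompson_rels `` {w}) = word_eval G x w"
    and img: "h ` carrier thompson_F = generate G (range x)"
    unfolding thompson_F_eq using presented_group_hom[OF x_closed rels] by blast
  interpret H: group_hom thompson_F G h
    by (intro group_hom.intro F.is_group is_group group_hom_axioms.intro hom)
  have hy: "h (y i) = x i" for i
    by (simp add: y_def h)
  have hp: "h (gen_prod thompson_F y p) = gen_prod G x p" for p
    by (induction p) (simp_all add: hy)
  have pos_inj: "gen_prod thompson_F y p = gen_prod thompson_F y q"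
    if "gen_prod G x p = gen_prod G x q" for p q
    using that
  proof (induction "length p" arbitrary: p q rule: less_induct)
    case less
    show ?case
    proof (cases "set p \<union> set q = {}")
      case False
      define i where "i = Min (set p \<union> set q)"
      have min: "\<forall>j\<in>set p. i \<le> j" "\<forall>j\<in>set q. i \<le> j" "i \<in> set p \<union> set q"
        using False Min_in[of "set p \<union> set q"] by (auto simp: i_def)
      \<comment> \<open>If \<open>i\<close> were missing from \<open>p\<close>, it would be the
        least letter of \<open>q\<close> and lie below all of \<open>p\<close>, so
        \<open>separated\<close> with the two words exchanged would contradict the equality of the
        images.\<close>
      have "i \<in> set p"
        using min separated[of i q p] less.prems by (auto simp: nat_less_le)
      have "i \<in> set q"
        using min separated[of i p q] less.prems by (auto simp: nat_less_le)
      obtain p' where p': "length p = Suc (length p')"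
          "gen_prod thompson_F y p = y i \<otimes>\<^bsub>thompson_F\<^esub> gen_prod thompson_F y p'"
        using F.gen_prod_pull_min[OF \<open>i \<in> set p\<close>] min by blast
      obtain q' where q':
          "gen_prod thompson_F y q = y i \<otimes>\<^bsub>thompson_F\<^esub> gen_prod thompson_F y q'"
        using F.gen_prod_pull_min[OF \<open>i \<in> set q\<close>] min by blast
      have "x i \<otimes> gen_prod G x p' = x i \<otimes> gen_prod G x q'"
        using less.prems unfolding hp[symmetric] p' q' by (simp add: hy)
      then have "gen_prod G x p' = gen_prod G x q'" by simp
      then have "gen_prod thompson_F y p' = gen_prod thompson_F y q'"
        using less.hyps p'(1) by simp
      then show ?thesis by (simp add: p' q')
    qed simp
  qed
  have "inj_on h (carrier thompson_F)"
  proof (unfold H.inj_on_one_iff, intro allI impI)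
    fix a assume a: "a \<in> carrier thompson_F" "h a = \<one>"
    then obtain w where "a = word_eq thompson_rels `` {w}"
      by (auto simp: thompson_F_eq presented_group_def elim: quotientE)
    then have "a = word_eval thompson_F y w"
      by (simp add: y_def[abs_def] thompson_F_eq word_eval_presented_group)
    then obtain p q where pq:
        "a = gen_prod thompson_F y p \<otimes>\<^bsub>thompson_F\<^esub> inv\<^bsub>thompson_F\<^esub> gen_prod thompson_F y q"
      using F.word_eval_fraction by blast
    then have "gen_prod G x p \<otimes> inv gen_prod G x q = \<one>"
      using a(2) by (simp add: hp)
    then have "gen_prod G x p = gen_prod G x q"
      using inv_solve_right' by auto
    then show "a = \<one>\<^bsub>thompson_F\<^esub>"
      using pos_inj[of p q] pq by simp
  qed
  then have "h \<in> iso thompson_F (G\<lparr>carrier := generate G (range x)\<rparr>)"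
    using hom img by (auto simp: iso_def hom_def bij_betw_def)
  then show ?thesis
    using F.iso_sym by (auto simp: is_iso_def)
qed

end

section \<open>A Thompson sequence built from two elements\<close>

context group
begin

text \<open>With \<open>k = g \<otimes> f\<close>, inverting at index 0 turns
  \<open>inv (x 0) \<otimes> x j \<otimes> x 0\<close> into conjugation of \<open>x j\<close> by
  \<open>k\<close>, so raising an index transports the support by \<open>k\<close>. The exponent
  lags the index by one, so that \<open>x 1\<close> is \<open>inv g\<close>.\<close>

primrec two_gen_seq :: "'a \<Rightarrow> 'a \<Rightarrow> nat \<Rightarrow> 'a" where
  "two_gen_seq f g 0 = inv (g \<otimes> f)"
| "two_gen_seq f g (Suc m) = (g \<otimes> f) [^] m \<otimes> inv g \<otimes> inv ((g \<otimes> f) [^] m)"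

lemma two_gen_seq_closed:
  assumes "f \<in> carrier G" "g \<in> carrier G"
  shows "two_gen_seq f g i \<in> carrier G"
  using assms by (cases i) auto

lemma two_gen_seq_shift:
  assumes "f \<in> carrier G" "g \<in> carrier G"
  shows "two_gen_seq f g (Suc (l + m))
    = (g \<otimes> f) [^] l \<otimes> two_gen_seq f g (Suc m) \<otimes> inv ((g \<otimes> f) [^] l)"
  using assms by (simp add: nat_pow_mult[symmetric] inv_mult_group m_assoc)

lemma conj_inv_mult:
  assumes "c \<in> carrier G" "a \<in> carrier G" "b \<in> carrier G"
  shows "inv (c \<otimes> a \<otimes> inv c) \<otimes> (c \<otimes> b \<otimes> inv c) \<otimes> (c \<otimes> a \<otimes> inv c)
    = c \<otimes> (inv a \<otimes> b \<otimes> a) \<otimes> inv c"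
proof -
  have cancel: "inv c \<otimes> (c \<otimes> u) = u" if "u \<in> carrier G" for u
    using that assms by (simp flip: m_assoc)
  show ?thesis using assms by (simp add: inv_mult_group m_assoc cancel)
qed

text \<open>The relations with \<open>i = 0\<close> hold by construction. Those with
  \<open>i > 0\<close> are conjugate, by a power of \<open>g \<otimes> f\<close>, to relations with
  \<open>i = 1\<close>, and there \<open>commute\<close> suffices.\<close>

lemma thompson_sequence_two_gen_seq:
  assumes f: "f \<in> carrier G" and g: "g \<in> carrier G"
    and commute: "\<And>m. f \<otimes> two_gen_seq f g (Suc (Suc m)) = two_gen_seq f g (Suc (Suc m)) \<otimes> f"
  shows "thompson_sequence G (two_gen_seq f g)"
proof unfold_locales
  let ?x = "two_gen_seq f g"
  let ?k = "g \<otimes> f"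
  note closed = two_gen_seq_closed[OF f g]
  show "?x i \<in> carrier G" for i by (rule closed)
  have step: "?x (Suc (Suc m)) = ?k \<otimes> ?x (Suc m) \<otimes> inv ?k" for m
    using two_gen_seq_shift[OF f g, of 1 m] f g by simp
  have first: "inv (?x 1) \<otimes> ?x (Suc (Suc m)) \<otimes> ?x 1 = ?x (Suc (Suc (Suc m)))" for m
  proof -
    let ?y = "?x (Suc (Suc m))"
    have "inv (?x 1) \<otimes> ?y \<otimes> ?x 1 = g \<otimes> ?y \<otimes> inv g"
      using f g by (simp add: inv_mult_group)
    \<comment> \<open>Since \<open>f\<close> commutes with \<open>?y\<close>, a conjugation by
      \<open>f\<close> can be inserted, turning conjugation by \<open>g\<close> into conjugation by
      \<open>?k\<close>.\<close>
    also have "\<dots> = g \<otimes> (f \<otimes> ?y \<otimes> inv f) \<otimes> inv g"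
      using inv_solve_right[of ?y "f \<otimes> ?y" f] commute[of m] closed f by (metis m_closed)
    also have "\<dots> = ?k \<otimes> ?y \<otimes> inv ?k"
      using f g closed[of "Suc (Suc m)"] by (simp add: inv_mult_group m_assoc del: two_gen_seq.simps)
    finally show ?thesis unfolding step[of "Suc m"] .
  qed
  fix i j :: nat assume "i < j"
  show "inv (?x i) \<otimes> ?x j \<otimes> ?x i = ?x (Suc j)"
  proof (cases i)
    case 0
    with \<open>i < j\<close> obtain m where "j = Suc m" by (cases j) auto
    then show ?thesis using 0 step[of m] f g by simp
  next
    case (Suc l)
    \<comment> \<open>Removing the common conjugation by \<open>?k [^] l\<close> leaves the indices
      1 and \<open>r + 2\<close>; the second is at least 2, the range in which
      \<open>commute\<close> applies.\<close>
    with \<open>i < j\<close> obtain r where j: "j = Suc (l + Suc r)"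
      by (metis Suc_lessE add_Suc_right less_imp_Suc_add)
    let ?c = "?k [^] l"
    have c: "?c \<in> carrier G" using f g by simp
    have "?x i = ?c \<otimes> ?x 1 \<otimes> inv ?c"
      using two_gen_seq_shift[OF f g, of l 0] Suc by simp
    moreover have "?x j = ?c \<otimes> ?x (Suc (Suc r)) \<otimes> inv ?c"
      using two_gen_seq_shift[OF f g, of l "Suc r"] j by metis
    moreover have "?x (Suc j) = ?c \<otimes> ?x (Suc (Suc (Suc r))) \<otimes> inv ?c"
      using two_gen_seq_shift[OF f g, of l "Suc (Suc r)"] j by (metis add_Suc_right)
    ultimately show ?thesis
      using conj_inv_mult[OF c closed closed, of 1 "Suc (Suc r)"] first[of r] by metis
  qed
qed

text \<open>Both generators are recovered from the first two terms: \<open>g\<close> is the inverse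
  of \<open>x 1\<close>, and \<open>f\<close> is \<open>inv g\<close> times the inverse of
  \<open>x 0\<close>.\<close>

lemma generate_two_gen_seq:
  assumes f: "f \<in> carrier G" and g: "g \<in> carrier G"
  shows "generate G (range (two_gen_seq f g)) = generate G {f, g}"
proof
  let ?x = "two_gen_seq f g"
  have sub: "subgroup (generate G {f, g}) G" and sub': "subgroup (generate G (range ?x)) G"
    using two_gen_seq_closed[OF f g] f g by (auto intro!: generate_is_subgroup)
  have fg: "f \<in> generate G {f, g}" "g \<in> generate G {f, g}"
    by (auto intro: generate.incl)
  have k: "(g \<otimes> f) [^] m \<in> generate G {f, g}" for m :: nat
    by (induction m) (auto intro!: fg subgroup.m_closed[OF sub] subgroup.one_closed[OF sub])
  have "?x i \<in> generate G {f, g}" for i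
    by (cases i)
      (auto intro!: fg k subgroup.m_closed[OF sub] subgroup.m_inv_closed[OF sub])
  then show "generate G (range ?x) \<subseteq> generate G {f, g}"
    by (intro generate_subgroup_incl sub) auto
  have "inv (?x 1) \<in> generate G (range ?x)" "inv (?x 0) \<in> generate G (range ?x)"
    by (rule generate.inv, rule rangeI)+
  then have g': "g \<in> generate G (range ?x)" and k': "g \<otimes> f \<in> generate G (range ?x)"
    using f g by (auto simp: inv_mult_group)
  have "inv g \<otimes> (g \<otimes> f) \<in> generate G (range ?x)"
    by (rule subgroup.m_closed[OF sub' subgroup.m_inv_closed[OF sub' g'] k'])
  then have "f \<in> generate G (range ?x)"
    using f g by (simp flip: m_assoc)
  with g' show "generate G {f, g} \<subseteq> generate G (range ?x)"
    by (intro generate_subgroup_incl sub') auto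
qed

end

section \<open>Pairs of homeomorphisms generating Thompson's group\<close>

interpretation homeo: group homeo_plus
  by (rule group_homeo_plus)

lemma homeo_mult [simp]: "f \<otimes>\<^bsub>homeo_plus\<^esub> g = f \<circ> g"
  and homeo_one [simp]: "\<one>\<^bsub>homeo_plus\<^esub> = id"
  by (simp_all add: homeo_plus_def)

lemma homeo_pow [simp]: "f [^]\<^bsub>homeo_plus\<^esub> (N::nat) = f ^^ N"
  by (induction N) (simp_all only: homeo.nat_pow_0 homeo.nat_pow_Suc homeo_mult homeo_one
      funpow_Suc_right funpow.simps(1))

lemma homeo_strict_mono: "f \<in> carrier homeo_plus \<Longrightarrow> strict_mono f"
  by (simp add: homeo_plus_def)

lemma homeo_continuous: "f \<in> carrier homeo_plus \<Longrightarrow> continuous_on UNIV f"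
  by (auto simp: homeo_plus_def homeomorphism_def)

lemma homeo_inv_apply [simp]:
  assumes "f \<in> carrier homeo_plus"
  shows "f ((inv\<^bsub>homeo_plus\<^esub> f) t) = t" "(inv\<^bsub>homeo_plus\<^esub> f) (f t) = t"
  using fun_cong[OF homeo.r_inv[OF assms], of t] fun_cong[OF homeo.l_inv[OF assms], of t]
  by simp_all

lemma homeo_less_iff:
  assumes "f \<in> carrier homeo_plus"
  shows "f t < f u \<longleftrightarrow> t < u" "f t \<le> f u \<longleftrightarrow> t \<le> u"
  using homeo_strict_mono[OF assms] by (auto simp: strict_mono_less strict_mono_less_eq)

lemma homeo_inv_le_iff:
  assumes "f \<in> carrier homeo_plus"
  shows "(inv\<^bsub>homeo_plus\<^esub> f) t \<le> u \<longleftrightarrow> t \<le> f u" "(inv\<^bsub>homeo_plus\<^esub> f) t < u \<longleftrightarrow> t < f u"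
  using homeo_less_iff[OF assms, of "(inv\<^bsub>homeo_plus\<^esub> f) t" u] assms by simp_all

text \<open>By monotonicity each map preserves the ray that the other one fixes, so at every point
  only one of the two maps acts.\<close>

lemma commute_if_fixes_complementary_rays:
  fixes f h :: "'a::linorder \<Rightarrow> 'a"
  assumes "mono f" "mono h"
    and "\<And>t. s \<le> t \<Longrightarrow> f t = t" "\<And>t. t \<le> s \<Longrightarrow> h t = t"
  shows "f \<circ> h = h \<circ> f"
proof
  fix t
  show "(f \<circ> h) t = (h \<circ> f) t"
  proof (cases "t \<le> s")
    case True
    then have "f t \<le> s" using monoD[OF assms(1) True] assms(3)[of s] by simp
    then show ?thesis using True assms(4) by simp
  next
    case False
    then have "s \<le> h t" using monoD[OF assms(2), of s t] assms(4)[of s] by simp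
    then show ?thesis using False assms(3) by simp
  qed
qed

text \<open>The condition \<open>s \<le> g (f b)\<close> places the image of \<open>b\<close> under
  \<open>k\<close> beyond the part of the line moved by \<open>f\<close>. Hence the terms of index
  at least 2 commute with \<open>f\<close>, and the orbit of \<open>b\<close> under \<open>k\<close>
  then separates positive words.\<close>

lemma two_gen_iso_thompson_F:
  fixes f g :: "real \<Rightarrow> real"
  assumes f: "f \<in> carrier homeo_plus" and g: "g \<in> carrier homeo_plus"
    and f_ge: "\<And>t. t \<le> f t" and g_ge: "\<And>t. t \<le> g t"
    and g_fix: "\<And>t. t \<le> b \<Longrightarrow> g t = t" and f_fix: "\<And>t. s \<le> t \<Longrightarrow> f t = t"
    and "b < f b" "f b < g (f b)" "s \<le> g (f b)"
  shows "homeo_plus\<lparr>carrier := generate homeo_plus {f, g}\<rparr> \<cong> thompson_F"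
proof -
  define k where "k = g \<circ> f"
  define x where "x = homeo.two_gen_seq f g"
  \<comment> \<open>\<open>B i\<close> is the test point for index \<open>i\<close>:
    \<open>x i\<close> moves it, whereas \<open>x (Suc m)\<close> fixes everything up to
    \<open>B m\<close>, hence fixes \<open>B i\<close> whenever \<open>i \<le> m\<close>.\<close>
  define B where "B m = (k ^^ m) b" for m
  have k: "k \<in> carrier homeo_plus"
    using homeo.m_closed[OF g f] by (simp add: k_def)
  have km: "k ^^ m \<in> carrier homeo_plus" for m
    using homeo.nat_pow_closed[OF k, of m] by simp
  have x_closed: "x i \<in> carrier homeo_plus" for i
    unfolding x_def by (rule homeo.two_gen_seq_closed[OF f g])
  have x_0: "x 0 = inv\<^bsub>homeo_plus\<^esub> k"
    by (simp add: x_def k_def)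
  have x_Suc: "x (Suc m) t = (k ^^ m) ((inv\<^bsub>homeo_plus\<^esub> g) ((inv\<^bsub>homeo_plus\<^esub> (k ^^ m)) t))" for m t
    by (simp add: x_def k_def)
  have k_ge: "t \<le> k t" for t
    using f_ge g_ge order_trans by (fastforce simp: k_def)
  have x_le: "x i t \<le> t" for i t
  proof (cases i)
    case 0
    then show ?thesis using k_ge by (simp add: x_0 homeo_inv_le_iff[OF k])
  next
    case (Suc m)
    have "(inv\<^bsub>homeo_plus\<^esub> g) u \<le> u" for u
      using g_ge by (simp add: homeo_inv_le_iff[OF g])
    then have "x i t \<le> (k ^^ m) ((inv\<^bsub>homeo_plus\<^esub> (k ^^ m)) t)"
      unfolding Suc x_Suc by (simp only: homeo_less_iff[OF km])
    then show ?thesis by (simp add: km)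
  qed
  have x_fix: "x (Suc m) t = t" if "t \<le> B m" for m t
  proof -
    have "(inv\<^bsub>homeo_plus\<^esub> (k ^^ m)) t \<le> b"
      using that by (simp add: homeo_inv_le_iff[OF km] B_def)
    then have "(inv\<^bsub>homeo_plus\<^esub> g) ((inv\<^bsub>homeo_plus\<^esub> (k ^^ m)) t) = (inv\<^bsub>homeo_plus\<^esub> (k ^^ m)) t"
      using homeo_inv_apply(2)[OF g] g_fix by metis
    then show ?thesis by (simp add: x_Suc km)
  qed
  have x_move: "x i (B i) < B i" for i
  proof (cases i)
    case 0
    have "b < k b" using assms(7,8) by (simp add: k_def)
    then show ?thesis by (simp add: 0 x_0 B_def homeo_inv_le_iff[OF k])
  next
    case (Suc m)
    have B: "B i = (k ^^ m) (k b)"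
      unfolding B_def Suc funpow_Suc_right by simp
    have "k b < g (k b)"
      using assms(8) by (simp add: k_def homeo_less_iff[OF g])
    then have "(inv\<^bsub>homeo_plus\<^esub> g) (k b) < k b"
      by (simp add: homeo_inv_le_iff[OF g])
    then show ?thesis
      unfolding B unfolding Suc x_Suc by (simp add: km homeo_less_iff[OF km])
  qed
  have B_mono: "B i \<le> B m" if "i \<le> m" for i m
    using that by (rule lift_Suc_mono_le[rotated]) (simp add: B_def k_ge)
  have "s \<le> B (Suc m)" for m
    using B_mono[of 1 "Suc m"] assms(9) by (simp add: B_def k_def)
  then have commute: "f \<circ> x (Suc (Suc m)) = x (Suc (Suc m)) \<circ> f" for m
    using homeo_strict_mono[OF f] homeo_strict_mono[OF x_closed] f_fix x_fix order_trans
    by (intro commute_if_fixes_complementary_rays[of _ _ s]) (blast intro: strict_mono_mono)+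
  interpret thompson_sequence homeo_plus x
    unfolding x_def
    by (rule homeo.thompson_sequence_two_gen_seq[OF f g])
      (use commute in \<open>simp only: homeo_mult x_def\<close>)
  have prod_le: "gen_prod homeo_plus x p t \<le> t" for p t
  proof (induction p)
    case (Cons j p)
    then show ?case using x_le[of j "gen_prod homeo_plus x p t"] by simp
  qed simp
  have prod_fix: "gen_prod homeo_plus x p (B i) = B i" if "\<forall>j\<in>set p. i < j" for p i
    using that
  proof (induction p)
    case (Cons j p)
    then obtain m where "j = Suc m" "i \<le> m" by (cases j) auto
    with Cons show ?case using x_fix B_mono by simp
  qed simp
  have prod_move: "gen_prod homeo_plus x p (B i) < B i"
    if "i \<in> set p" "\<forall>j\<in>set p. i \<le> j" for p i
    using that
  proof (induction p)
    case (Cons j p)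
    show ?case
    \<comment> \<open>Letters act from the right end of the list. Either the tail has already moved
      \<open>B i\<close> left and the head cannot undo this, or the tail fixes \<open>B i\<close>
      and the head is \<open>x i\<close> itself.\<close>
    proof (cases "i \<in> set p")
      case True
      then have "gen_prod homeo_plus x p (B i) < B i" using Cons by simp
      then show ?thesis using x_le[of j "gen_prod homeo_plus x p (B i)"] by simp
    next
      case False
      then have "j = i" "\<forall>j\<in>set p. i < j" using Cons.prems by (auto simp: nat_less_le)
      then show ?thesis using prod_fix x_move by simp
    qed
  qed simp
  have "homeo_plus\<lparr>carrier := generate homeo_plus (range x)\<rparr> \<cong> thompson_F"
  proof (rule generate_iso_thompson_F)
    fix i :: nat and p q :: "nat list"
    assume "i \<in> set p" "\<forall>j\<in>set p. i \<le> j" "\<forall>j\<in>set q. i < j"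
    then show "gen_prod homeo_plus x p \<noteq> gen_prod homeo_plus x q"
      using prod_move[of i p] prod_fix[of q i] by auto
  qed
  then show ?thesis
    unfolding x_def homeo.generate_two_gen_seq[OF f g] .
qed

section \<open>Dynamics of large powers\<close>

lemma funpow_ge:
  fixes f :: "'a::order \<Rightarrow> 'a"
  assumes "\<And>t. t \<le> f t" "m \<le> n"
  shows "(f ^^ m) t \<le> (f ^^ n) t"
  using assms(2) by (rule lift_Suc_mono_le[rotated]) (simp add: assms(1))

lemma supp_funpow:
  assumes "\<And>t. t \<le> f t" "0 < N"
  shows "supp (f ^^ N) = supp f"
proof -
  have "(f ^^ N) t = t \<longleftrightarrow> f t = t" for t
  proof
    assume "(f ^^ N) t = t"
    then have "f t \<le> t" using funpow_ge[OF assms(1), of 1 N t] assms(2) by simp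
    then show "f t = t" using assms(1)[of t] by simp
  next
    assume "f t = t"
    then show "(f ^^ N) t = t" by (induction N) auto
  qed
  then show ?thesis by (auto simp: supp_def)
qed

text \<open>An orbit staying below \<open>s\<close> would increase to a limit in the interval from
  \<open>u\<close> to \<open>s\<close>, and by continuity this limit would be a fixed point, which
  \<open>move\<close> excludes.\<close>

lemma eventually_funpow_ge:
  fixes g :: "real \<Rightarrow> real"
  assumes cont: "continuous_on UNIV g" and g_ge: "\<And>t. t \<le> g t"
    and move: "\<And>t. u \<le> t \<Longrightarrow> t \<le> s \<Longrightarrow> g t \<noteq> t"
  shows "\<forall>\<^sub>F N in sequentially. s \<le> (g ^^ N) u"
proof -
  have "\<exists>M. s \<le> (g ^^ M) u"
  proof (rule ccontr)
    assume "\<not> ?thesis"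
    then have bound: "(g ^^ M) u \<le> s" for M by (simp add: not_le less_imp_le)
    obtain L where L: "(\<lambda>M. (g ^^ M) u) \<longlonglongrightarrow> L"
      by (rule incseq_convergent[of "\<lambda>M. (g ^^ M) u" s])
        (use bound funpow_ge[OF g_ge] in \<open>auto simp: incseq_def\<close>)
    have "(\<lambda>M. g ((g ^^ M) u)) \<longlonglongrightarrow> g L"
      using cont L by (auto simp: continuous_on_eq_continuous_at intro: isCont_tendsto_compose)
    moreover have "(\<lambda>M. g ((g ^^ M) u)) \<longlonglongrightarrow> L"
      using LIMSEQ_Suc[OF L] by simp
    ultimately have "g L = L" by (rule LIMSEQ_unique)
    moreover have "u \<le> L"
      using LIMSEQ_le_const[OF L, of u] funpow_ge[OF g_ge, of 0] by auto
    moreover have "L \<le> s"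
      using LIMSEQ_le_const2[OF L, of s] bound by auto
    ultimately show False using move by blast
  qed
  then obtain M where "s \<le> (g ^^ M) u" ..
  then have "s \<le> (g ^^ N) u" if "M \<le> N" for N
    using funpow_ge[OF g_ge that] order_trans by blast
  then show ?thesis by (auto simp: eventually_sequentially)
qed

lemma eventually_two_gen_iso_thompson_F:
  fixes f g :: "real \<Rightarrow> real"
  assumes f: "f \<in> carrier homeo_plus" and g: "g \<in> carrier homeo_plus"
    and f_ge: "\<And>t. t \<le> f t" and g_ge: "\<And>t. t \<le> g t"
    and f_int: "is_interval (supp f)" and g_int: "is_interval (supp g)" and "open (supp g)"
    and less: "left_endpoint (supp f) < left_endpoint (supp g)"
    and "supp f \<inter> supp g \<noteq> {}" "\<not> supp g \<subseteq> supp f"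
  shows "\<forall>\<^sub>F N in sequentially.
    homeo_plus\<lparr>carrier := generate homeo_plus {f ^^ N, g ^^ N}\<rparr> \<cong> thompson_F"
proof -
  obtain m where m: "m \<in> supp f" "m \<in> supp g" using assms by blast
  obtain s where s: "s \<in> supp g" "s \<notin> supp f" using assms by blast
  have "left_endpoint (supp g) \<le> ereal m"
    unfolding left_endpoint_def using m by (auto intro: INF_lower)
  \<comment> \<open>The left endpoint of \<open>supp g\<close> is finite: it exceeds that of
    \<open>supp f\<close> and is at most \<open>m\<close>.\<close>
  then obtain b where b: "left_endpoint (supp g) = ereal b"
    using less by (cases "left_endpoint (supp g)") auto
  have above: "b \<le> t" if "t \<in> supp g" for t
    using INF_lower[of t "supp g" ereal] that b unfolding left_endpoint_def by simp
  have "b \<notin> supp g"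
  proof
    assume "b \<in> supp g"
    then obtain e where "0 < e" "ball b e \<subseteq> supp g"
      using \<open>open (supp g)\<close> openE by blast
    then have "b - e / 2 \<in> supp g" by (auto simp: dist_real_def)
    with above \<open>0 < e\<close> show False by fastforce
  qed
  then have above: "b < t" if "t \<in> supp g" for t
    using above[OF that] that by (cases "b = t") auto
  then have g_fix: "g t = t" if "t \<le> b" for t
    using that by (fastforce simp: supp_def)
  obtain r where r: "r \<in> supp f" "r < b"
    using less unfolding b by (auto simp: left_endpoint_def INF_less_iff)
  \<comment> \<open>The point \<open>b\<close> lies between \<open>r\<close> and \<open>m\<close>,
    both in the interval \<open>supp f\<close>.\<close>
  have "b \<in> supp f"
    using mem_is_interval_1_I[OF f_int r(1) m(1)] r(2) above[OF m(2)] by simp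
  then have "b < f b" using f_ge[of b] by (simp add: supp_def)
  have "b < s" using above s by blast
  have f_fix: "f t = t" if "s \<le> t" for t
  proof (rule ccontr)
    assume "f t \<noteq> t"
    then have "s \<in> supp f"
      using mem_is_interval_1_I[OF f_int \<open>b \<in> supp f\<close>, of t s] \<open>b < s\<close> that
      by (simp add: supp_def)
    with s show False by blast
  qed
  have "f b < s"
    using homeo_less_iff(1)[OF f, of b s] \<open>b < s\<close> f_fix[of s] by simp
  have g_move: "g t \<noteq> t" if "b < t" "t \<le> s" for t
  proof -
    have "left_endpoint (supp g) < ereal t" using that b by simp
    then obtain y where "y \<in> supp g" "y < t"
      by (auto simp: left_endpoint_def INF_less_iff)
    then have "t \<in> supp g" using mem_is_interval_1_I[OF g_int _ s(1), of y t] that by simp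
    then show ?thesis by (simp add: supp_def)
  qed
  \<comment> \<open>The orbit starts at \<open>f b\<close> because \<open>g\<close> fixes
    \<open>b\<close>. This start is independent of \<open>N\<close>, and \<open>(f ^^ N) b\<close>
    lies at or beyond it once \<open>N\<close> is positive.\<close>
  have "\<forall>\<^sub>F N in sequentially. s \<le> (g ^^ N) (f b)"
    using \<open>b < f b\<close> by (intro eventually_funpow_ge homeo_continuous g g_ge g_move) auto
  then show ?thesis
    using eventually_gt_at_top[of 0]
  proof eventually_elim
    case (elim N)
    let ?f = "f ^^ N" and ?g = "g ^^ N"
    have closed: "?f \<in> carrier homeo_plus" "?g \<in> carrier homeo_plus"
      using homeo.nat_pow_closed[OF f, of N] homeo.nat_pow_closed[OF g, of N] by simp_all
    have ge: "t \<le> ?f t" "t \<le> ?g t" for t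
      using funpow_ge[OF f_ge, of 0 N t] funpow_ge[OF g_ge, of 0 N t] by simp_all
    have fix_iff: "?f t = t \<longleftrightarrow> f t = t" "?g t = t \<longleftrightarrow> g t = t" for t
      using supp_funpow[OF f_ge elim(2)] supp_funpow[OF g_ge elim(2)]
      by (auto simp: supp_def set_eq_iff)
    have f_b: "f b \<le> ?f b" using funpow_ge[OF f_ge, of 1 N b] elim(2) by simp
    \<comment> \<open>As \<open>?f\<close> fixes \<open>s\<close>, the point \<open>?f b\<close>
      stays strictly between \<open>b\<close> and \<open>s\<close>, where \<open>g\<close> has no
      fixed point.\<close>
    have "?f b < s"
      using homeo_less_iff(1)[OF closed(1), of b s] \<open>b < s\<close> fix_iff(1)[of s, THEN iffD2] f_fix[of s]
      by simp
    then have "?g (?f b) \<noteq> ?f b"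
      using g_move[of "?f b"] fix_iff f_b \<open>b < f b\<close> by simp
    then have "?f b < ?g (?f b)" using ge(2)[of "?f b"] by simp
    moreover have "s \<le> ?g (?f b)"
      using elim(1) f_b homeo_less_iff(2)[OF closed(2)] order_trans by blast
    ultimately show ?case
      using closed ge g_fix f_fix fix_iff f_b \<open>b < f b\<close>
      by (intro two_gen_iso_thompson_F[of ?f ?g b s]) auto
  qed
qed

section \<open>From consecutive pairs to the whole chain\<close>

theorem theorem1p1:
  fixes n :: nat
    and J :: "nat \<Rightarrow> real set"
    and f :: "nat \<Rightarrow> real \<Rightarrow> real"
  assumes "n \<ge> 2"
    and "chain_of_intervals n J"
    and "increasing_left_endpoints n J"
    and "\<And>i. i \<in> {1..n} \<Longrightarrow> f i \<in> carrier homeo_plus"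
    and "\<And>i. i \<in> {1..n} \<Longrightarrow> supp (f i) = J i"
    and "\<And>i t. i \<in> {1..n} \<Longrightarrow> f i t \<ge> t"
  shows "\<exists>N\<^sub>0::nat. \<forall>N\<ge>N\<^sub>0.
    chain_group n (\<lambda>i. f i [^]\<^bsub>homeo_plus\<^esub> N)
      (generate homeo_plus {g [^]\<^bsub>homeo_plus\<^esub> N | g. g \<in> f ` {1..n}})"
proof -
  have "\<forall>\<^sub>F N in sequentially. \<forall>i\<in>{1..<n}.
      homeo_plus\<lparr>carrier := generate homeo_plus {f i ^^ N, f (i + 1) ^^ N}\<rparr> \<cong> thompson_F"
  \<comment> \<open>There are finitely many consecutive pairs, so their thresholds combine into
    one.\<close>
  proof (intro eventually_ball_finite ballI)
    fix i assume i: "i \<in> {1..<n}"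
    then have in_n: "i \<in> {1..n}" "i + 1 \<in> {1..n}" by auto
    note supp = assms(5)[OF in_n(1)] assms(5)[OF in_n(2)]
    have "is_interval (J i)" "is_interval (J (i + 1))" "open (J (i + 1))"
      using assms(2) in_n unfolding chain_of_intervals_def by blast+
    moreover have "left_endpoint (J i) < left_endpoint (J (i + 1))"
      using assms(3) i unfolding increasing_left_endpoints_def by blast
    moreover have "J i \<inter> J (i + 1) \<noteq> {}" "\<not> J (i + 1) \<subseteq> J i"
      using assms(2) i unfolding chain_of_intervals_def proper_subinterval_def by blast+
    ultimately show "\<forall>\<^sub>F N in sequentially.
        homeo_plus\<lparr>carrier := generate homeo_plus {f i ^^ N, f (i + 1) ^^ N}\<rparr> \<cong> thompson_F"
      using in_n unfolding supp[symmetric]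
      by (intro eventually_two_gen_iso_thompson_F assms(4,6))
  qed simp
  then have "\<forall>\<^sub>F N in sequentially. chain_group n (\<lambda>i. f i [^]\<^bsub>homeo_plus\<^esub> N)
      (generate homeo_plus {g [^]\<^bsub>homeo_plus\<^esub> N | g. g \<in> f ` {1..n}})"
    \<comment> \<open>Positive powers have the same supports as the original maps; the zeroth power
      would have empty support.\<close>
    using eventually_gt_at_top[of 0]
  proof eventually_elim
    case (elim N)
    have supp: "supp (f i ^^ N) = J i" if "i \<in> {1..n}" for i
      using supp_funpow[OF assms(6)[OF that] elim(2)] assms(5)[OF that] by simp
    have "chain_of_intervals n (\<lambda>i. supp (f i ^^ N))"
      using assms(2) supp by (simp add: chain_of_intervals_def)
    moreover have "increasing_left_endpoints n (\<lambda>i. supp (f i ^^ N))"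
      using assms(3) supp by (simp add: increasing_left_endpoints_def)
    moreover have "f i ^^ N \<in> carrier homeo_plus" if "i \<in> {1..n}" for i
      using homeo.nat_pow_closed[OF assms(4)[OF that], of N] by simp
    moreover have "t \<le> (f i ^^ N) t" if "i \<in> {1..n}" for i t
      using funpow_ge[OF assms(6)[OF that], of 0 N t] by simp
    moreover have "{g ^^ N | g. g \<in> f ` {1..n}} = (\<lambda>i. f i ^^ N) ` {1..n}"
      by auto
    ultimately show ?case
      using elim(1) \<open>n \<ge> 2\<close> by (simp add: chain_group_def prechain_group_def)
  qed
  then show ?thesis by (simp add: eventually_sequentially)
qed

end
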